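(* Let $K$ be an algebraically closed field of characteristic zero, let $m,n$ be positive integers, let $\alpha\in K$ be a primitive $m$-th root of unity and $\beta\in K$ a primitive $n$-th root of unity, and let $\mathbb{U}_m=\langle\alpha\rangle$, $\mathbb{U}_n=\langle\beta\rangle$. Given positive integers $i,j,t,x$ satisfying the conditions $$i\mid m,\quad j\mid n,\quad t\mid \tfrac{m}{i},\quad t\mid\tfrac{n}{j},\quad \gcd(x,t)=1,\quad 1\le x\le t, \qquad ( * )$$ let $$H_{i,j,t,x}=\{(\alpha^{ai},\beta^{bj}) : a,b\in\mathbb{Z},\ b\equiv ax \pmod t\}.$$ Then the $H_{i,j,t,x}$ are subgroups of $\mathbb{U}_m\times\mathbb{U}_n$. And given any subgroup $G$ of $\mathbb{U}_m\times\mathbb{U}_n$, there exist unique positive integers $i,j,t,x$ satisfying $( * )$ such that $G=H_{i,j,t,x}$.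
   Context: $\mathbb{U}_m$ and $\mathbb{U}_n$ are multiplicative cyclic groups of orders $m$ and $n$. *)

theory Defs
  imports "HOL-Algebra.Algebra" "HOL-Number_Theory.Cong"
begin

definition char_zero :: "('a, 'b) ring_scheme \<Rightarrow> bool"
  where "char_zero K \<longleftrightarrow> (\<forall>k::nat. k > 0 \<longrightarrow> [k] \<cdot>\<^bsub>K\<^esub> \<one>\<^bsub>K\<^esub> \<noteq> \<zero>\<^bsub>K\<^esub>)"

definition primitive_root_of_unity :: "('a, 'b) ring_scheme \<Rightarrow> nat \<Rightarrow> 'a \<Rightarrow> bool"
  where "primitive_root_of_unity K m z \<longleftrightarrow>
    m > 0 \<and> z \<in> carrier K \<and> z [^]\<^bsub>K\<^esub> m = \<one>\<^bsub>K\<^esub> \<and>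
    (\<forall>k. 0 < k \<and> k < m \<longrightarrow> z [^]\<^bsub>K\<^esub> k \<noteq> \<one>\<^bsub>K\<^esub>)"

definition cyclic_units :: "('a, 'b) ring_scheme \<Rightarrow> 'a \<Rightarrow> 'a monoid"
  where "cyclic_units K z = subgroup_generated (mult_of K) {z}"

definition admissible :: "nat \<Rightarrow> nat \<Rightarrow> nat \<Rightarrow> nat \<Rightarrow> nat \<Rightarrow> nat \<Rightarrow> bool"
  where "admissible m n i j t x \<longleftrightarrow>
    i > 0 \<and> j > 0 \<and> t > 0 \<and> x > 0 \<and>
    i dvd m \<and> j dvd n \<and> t dvd m div i \<and> t dvd n div j \<and>
    gcd x t = 1 \<and> 1 \<le> x \<and> x \<le> t"

text \<open>Integer exponents are taken in the multiplicative group \<^term>\<open>mult_of K\<close>, where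
  negative powers are field inverses.\<close>

definition H_set :: "('a, 'b) ring_scheme \<Rightarrow> 'a \<Rightarrow> 'a \<Rightarrow> nat \<Rightarrow> nat \<Rightarrow> nat \<Rightarrow> nat \<Rightarrow> ('a \<times> 'a) set"
  where "H_set K \<alpha> \<beta> i j t x =
    {(\<alpha> [^]\<^bsub>mult_of K\<^esub> (a * int i), \<beta> [^]\<^bsub>mult_of K\<^esub> (b * int j)) | a b :: int.
      [b = a * int x] (mod int t)}"

end

theory Submission
  imports Defs
begin

text \<open>
  Since \<open>(u, v) \<mapsto> (\<alpha>\<^sup>u, \<beta>\<^sup>v)\<close> maps \<open>\<int> \<times> \<int>\<close> onto \<open>\<U>\<^sub>m \<times> \<U>\<^sub>n\<close> with kernel \<open>m\<int> \<times> n\<int>\<close>, subgroups of the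
  product correspond to lattices containing \<open>(m, 0)\<close> and \<open>(0, n)\<close>. Such a lattice \<open>L\<close> has first
  projection \<open>i\<int>\<close> and second projection \<open>j\<int>\<close>. Choose \<open>(i, xj)\<close> and \<open>(yi, j)\<close> in \<open>L\<close>, and let \<open>t\<close> and
  \<open>s\<close> generate \<open>{a. (ai, 0) \<in> L}\<close> and \<open>{b. (0, bj) \<in> L}\<close>. Then \<open>xy \<equiv> 1\<close> modulo both \<open>t\<close> and \<open>s\<close>, while
  \<open>s dvd tx\<close> and \<open>t dvd sy\<close>, whence \<open>s = t\<close>. Finally \<open>(ai, bj) \<in> L\<close> iff \<open>(0, (b - ax)j) \<in> L\<close>, that is,
  iff \<open>b \<equiv> ax\<close> modulo \<open>t\<close>.
\<close>

section \<open>Subgroups of the integers and of the integer plane\<close>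

abbreviation int_plane :: "(int \<times> int) monoid"
  where "int_plane \<equiv> integer_group \<times>\<times> integer_group"

text \<open>These are the exponent pairs occurring in \<open>H_set\<close>, kept as integers before
  any reduction modulo the orders of the two roots.\<close>

definition index_lattice :: "nat \<Rightarrow> nat \<Rightarrow> nat \<Rightarrow> nat \<Rightarrow> (int \<times> int) set"
  where "index_lattice i j t x =
    {(a * int i, b * int j) | a b. [b = a * int x] (mod int t)}"

lemma index_latticeI:
  "[b = a * int x] (mod int t) \<Longrightarrow> (a * int i, b * int j) \<in> index_lattice i j t x"
  unfolding index_lattice_def by blast

lemma group_int_plane: "group int_plane"
  by (simp add: DirProd_group)

lemma integer_subgroup_diff:
  assumes "subgroup S integer_group" "u \<in> S" "v \<in> S"
  shows "u - v \<in> S"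
  using subgroup.m_closed[OF assms(1,2) subgroup.m_inv_closed[OF assms(1,3)]] by simp

text \<open>Division with remainder by the least positive element \<open>d\<close>: a nonzero
  remainder would be a smaller positive element. The given positive \<open>p\<close> rules out the
  zero subgroup, so that \<open>d > 0\<close>.\<close>

lemma integer_subgroup_eq_multiples:
  assumes S: "subgroup S integer_group" and p: "int p \<in> S" "p > 0"
  obtains d :: nat where "d > 0" "\<And>k. k \<in> S \<longleftrightarrow> int d dvd k"
proof -
  define d where "d = (LEAST d. d > 0 \<and> int d \<in> S)"
  have d: "d > 0" "int d \<in> S"
    using LeastI[of "\<lambda>d. d > 0 \<and> int d \<in> S" p] p unfolding d_def by auto
  have mult: "k * int d \<in> S" for k
    using group.subgroup_int_pow_closed[OF group_integer_group S d(2), of k] by simp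
  have "k \<in> S \<longleftrightarrow> int d dvd k" for k
  proof
    assume "k \<in> S"
    then have mem: "k mod int d \<in> S"
      using integer_subgroup_diff[OF S _ mult, of k "k div int d"] by (simp add: minus_div_mult_eq_mod)
    have "k mod int d = 0"
    proof (rule ccontr)
      assume "k mod int d \<noteq> 0"
      moreover have "k mod int d \<ge> 0" "k mod int d < int d" using d by auto
      ultimately have "0 < nat (k mod int d)" "nat (k mod int d) < d" "int (nat (k mod int d)) \<in> S"
        using mem by auto
      then show False using not_less_Least[of "nat (k mod int d)" "\<lambda>d. d > 0 \<and> int d \<in> S"]
        unfolding d_def by blast
    qed
    then show "int d dvd k" by (simp add: dvd_eq_mod_eq_0)
  next
    assume "int d dvd k"
    then show "k \<in> S" using mult by (metis dvd_def mult.commute)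
  qed
  with d that show thesis by blast
qed

section \<open>Finding the parameters of a lattice\<close>

context
  fixes L :: "(int \<times> int) set"
  assumes L: "subgroup L int_plane"
begin

lemma lattice_zero: "(0, 0) \<in> L"
  using subgroup.one_closed[OF L] by simp

lemma lattice_add: "(u, v) \<in> L \<Longrightarrow> (u', v') \<in> L \<Longrightarrow> (u + u', v + v') \<in> L"
  using subgroup.m_closed[OF L, of "(u, v)" "(u', v')"] by simp

lemma lattice_uminus: "(u, v) \<in> L \<Longrightarrow> (- u, - v) \<in> L"
  using subgroup.m_inv_closed[OF L, of "(u, v)"] by simp

lemma lattice_diff: "(u, v) \<in> L \<Longrightarrow> (u', v') \<in> L \<Longrightarrow> (u - u', v - v') \<in> L"
  using lattice_add[of u v "- u'" "- v'"] lattice_uminus[of u' v'] by simp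

lemma lattice_scale:
  assumes "(u, v) \<in> L" shows "(k * u, k * v) \<in> L"
proof (induction k rule: int_induct[where k = 0])
  case base
  show ?case using lattice_zero by simp
next
  case (step1 k)
  show ?case using lattice_add[OF step1(2) assms] by (simp add: algebra_simps)
next
  case (step2 k)
  show ?case using lattice_diff[OF step2(2) assms] by (simp add: algebra_simps)
qed

lemma subgroup_lattice_fst: "subgroup (fst ` L) integer_group"
proof (rule group_hom.subgroup_img_is_subgroup[OF _ L])
  show "group_hom int_plane integer_group fst"
    using group_int_plane by (auto simp: group_hom_def group_hom_axioms_def hom_def)
qed

lemma subgroup_lattice_snd: "subgroup (snd ` L) integer_group"
proof (rule group_hom.subgroup_img_is_subgroup[OF _ L])
  show "group_hom int_plane integer_group snd"
    using group_int_plane by (auto simp: group_hom_def group_hom_axioms_def hom_def)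
qed

text \<open>The directions used below are \<open>(i, 0)\<close> and \<open>(0, j)\<close>. They make
  the intersections of \<open>L\<close> with the two axes into subgroups of the integers, whose
  generators are \<open>t\<close> and \<open>s\<close>.\<close>

lemma subgroup_lattice_section: "subgroup {k. (k * p, k * q) \<in> L} integer_group"
proof (rule group.subgroupI[OF group_integer_group])
  show "{k. (k * p, k * q) \<in> L} \<noteq> {}"
    using lattice_zero by (auto intro!: exI[of _ 0])
  show "inv\<^bsub>integer_group\<^esub> k \<in> {k. (k * p, k * q) \<in> L}" if "k \<in> {k. (k * p, k * q) \<in> L}" for k
    using that lattice_uminus by auto
  show "k \<otimes>\<^bsub>integer_group\<^esub> l \<in> {k. (k * p, k * q) \<in> L}"
    if "k \<in> {k. (k * p, k * q) \<in> L}" "l \<in> {k. (k * p, k * q) \<in> L}" for k l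
    using that lattice_add by (simp add: distrib_right)
qed simp

lemma lattice_eq_index_lattice:
  assumes "m > 0" "n > 0" and m: "(int m, 0) \<in> L" and n: "(0, int n) \<in> L"
  obtains i j t x where "admissible m n i j t x" "L = index_lattice i j t x"
proof -
  have mL: "int m \<in> fst ` L" and nL: "int n \<in> snd ` L"
    using image_eqI[OF _ m, of "int m" fst] image_eqI[OF _ n, of "int n" snd] by simp_all
  obtain i where "i > 0" and i: "\<And>k. k \<in> fst ` L \<longleftrightarrow> int i dvd k"
    using integer_subgroup_eq_multiples[OF subgroup_lattice_fst mL assms(1)] by blast
  obtain j where "j > 0" and j: "\<And>k. k \<in> snd ` L \<longleftrightarrow> int j dvd k"
    using integer_subgroup_eq_multiples[OF subgroup_lattice_snd nL assms(2)] by blast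
  have "i dvd m" "j dvd n" using i[of "int m"] j[of "int n"] mL nL by simp_all
  then have mi: "m = (m div i) * i" "m div i > 0" and nj: "n = (n div j) * j" "n div j > 0"
    using assms(1,2) \<open>i > 0\<close> \<open>j > 0\<close> by (simp_all add: div_greater_zero_iff dvd_imp_le)
  have "(int (m div i) * int i, int (m div i) * 0) \<in> L"
    using m mi(1) by (simp flip: of_nat_mult)
  then obtain t where "t > 0" and t: "\<And>a. (a * int i, 0) \<in> L \<longleftrightarrow> int t dvd a"
    using integer_subgroup_eq_multiples[OF subgroup_lattice_section[of "int i" 0], of "m div i"] mi(2)
    by auto
  have "(int (n div j) * 0, int (n div j) * int j) \<in> L"
    using n nj(1) by (simp flip: of_nat_mult)
  then obtain s where "s > 0" and s: "\<And>b. (0, b * int j) \<in> L \<longleftrightarrow> int s dvd b"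
    using integer_subgroup_eq_multiples[OF subgroup_lattice_section[of 0 "int j"], of "n div j"] nj(2)
    by auto
  \<comment> \<open>Some pair in \<open>L\<close> has first coordinate \<open>i\<close>. Its second
    coordinate lies in the second projection, hence is a multiple of \<open>j\<close>.\<close>
  obtain x0 where x0: "(int i, x0 * int j) \<in> L"
  proof -
    have "int i \<in> fst ` L" using i by simp
    then obtain v where v: "(int i, v) \<in> L" by auto
    have "int j dvd v" using j[of v] image_eqI[OF _ v, of v snd] by simp
    with v that show thesis by (auto elim!: dvdE simp: mult.commute)
  qed
  obtain y0 where y0: "(y0 * int i, int j) \<in> L"
  proof -
    have "int j \<in> snd ` L" using j by simp
    then obtain u where u: "(u, int j) \<in> L" by auto
    have "int i dvd u" using i[of u] image_eqI[OF _ u, of u fst] by simp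
    with u that show thesis by (auto elim!: dvdE simp: mult.commute)
  qed
  \<comment> \<open>Subtract \<open>(t * i, 0)\<close> from \<open>t\<close> times
    \<open>(i, x0 * j)\<close>.\<close>
  have "(0, (int t * x0) * int j) \<in> L"
    using lattice_diff[OF lattice_scale[OF x0, of "int t"], of "int t * int i" 0] t[of "int t"]
    by (simp add: mult.assoc)
  then have stx: "int s dvd int t * x0" using s by blast
  have "((int s * y0) * int i, 0) \<in> L"
    using lattice_diff[OF lattice_scale[OF y0, of "int s"], of 0 "int s * int j"] s[of "int s"]
    by (simp add: mult.assoc)
  then have tsy: "int t dvd int s * y0" using t by blast
  \<comment> \<open>Subtract \<open>(i, x0 * j)\<close> from \<open>x0\<close> times
    \<open>(y0 * i, j)\<close>: the second coordinates cancel.\<close>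
  have "((x0 * y0 - 1) * int i, 0) \<in> L"
    using lattice_diff[OF lattice_scale[OF y0, of x0] x0] by (simp add: algebra_simps)
  then have txy: "int t dvd x0 * y0 - 1" using t by blast
  have "(0, (x0 * y0 - 1) * int j) \<in> L"
    using lattice_diff[OF lattice_scale[OF x0, of y0] y0] by (simp add: algebra_simps)
  then have sxy: "int s dvd x0 * y0 - 1" using s by blast
  \<comment> \<open>An element with an inverse \<open>c\<close> modulo \<open>d\<close> is coprime
    to \<open>d\<close>. This allows \<open>x0\<close> and \<open>y0\<close> to be cancelled from
    \<open>stx\<close> and \<open>tsy\<close>.\<close>
  have unit: "coprime a b" if "d dvd a * c - 1" "b = d" for a b c d :: int
  proof (rule coprimeI)
    fix e assume e: "e dvd a" "e dvd b"
    then have "e dvd a * c" "e dvd a * c - 1" using that by (auto intro: dvd_trans)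
    then have "e dvd a * c - (a * c - 1)" by (rule dvd_diff)
    then show "is_unit e" by simp
  qed
  have "coprime (int s) x0" and cop: "coprime x0 (int t)" and "coprime (int t) y0"
    using unit[OF sxy refl] unit[OF txy refl] unit[of "int t" y0 x0] txy
    by (simp_all add: mult.commute coprime_commute)
  then have "int s dvd int t" "int t dvd int s"
    using stx tsy coprime_dvd_mult_left_iff by blast+
  then have "s dvd t" "t dvd s" by simp_all
  then have "s = t" by (rule dvd_antisym)
  have "int t dvd int (m div i)"
    using \<open>(int (m div i) * int i, int (m div i) * 0) \<in> L\<close> t by simp
  moreover have "int t dvd int (n div j)"
    using \<open>(int (n div j) * 0, int (n div j) * int j) \<in> L\<close> s \<open>s = t\<close> by simp
  \<comment> \<open>The shift by one picks the representative of \<open>x0\<close> modulo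
    \<open>t\<close> in the range from 1 to \<open>t\<close> instead of 0 to \<open>t - 1\<close>;
    for \<open>t = 1\<close> it gives \<open>x = 1\<close>.\<close>
  moreover define x where "x = nat ((x0 - 1) mod int t + 1)"
  have x_int: "int x = (x0 - 1) mod int t + 1" using \<open>t > 0\<close> by (simp add: x_def)
  have x_cong: "[int x = x0] (mod int t)"
    unfolding x_int cong_def by (simp add: mod_simps)
  have "0 \<le> (x0 - 1) mod int t" "(x0 - 1) mod int t < int t" using \<open>t > 0\<close> by auto
  then have "1 \<le> x" "x \<le> t" using x_int by linarith+
  moreover have "gcd x t = 1"
  proof -
    have "gcd (int x) (int t) = gcd x0 (int t)" using x_cong by (rule cong_gcd_eq)
    then show ?thesis using cop by (metis coprime_iff_gcd_eq_1 gcd_int_int_eq of_nat_eq_1_iff)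
  qed
  ultimately have adm: "admissible m n i j t x"
    unfolding admissible_def
    using \<open>i > 0\<close> \<open>j > 0\<close> \<open>t > 0\<close> \<open>i dvd m\<close> \<open>j dvd n\<close> by simp
  have mem: "(a * int i, b * int j) \<in> L \<longleftrightarrow> [b = a * int x] (mod int t)" for a b
  proof -
    have base: "(a * int i, (a * x0) * int j) \<in> L"
      using lattice_scale[OF x0, of a] by (simp add: mult.assoc)
    \<comment> \<open>Translating by \<open>base\<close>, which lies in \<open>L\<close>, reduces
      membership to the second axis, where \<open>s\<close> decides it.\<close>
    have "(a * int i, b * int j) \<in> L \<longleftrightarrow> (0, (b - a * x0) * int j) \<in> L"
      using lattice_diff[OF _ base, of "a * int i" "b * int j"]
        lattice_add[OF base, of 0 "(b - a * x0) * int j"]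
      by (auto simp: algebra_simps)
    also have "\<dots> \<longleftrightarrow> [b = a * x0] (mod int t)"
      using s \<open>s = t\<close> by (simp add: cong_iff_dvd_diff)
    also have "\<dots> \<longleftrightarrow> [b = a * int x] (mod int t)"
      using cong_scalar_left[OF x_cong, of a] by (meson cong_sym cong_trans)
    finally show ?thesis .
  qed
  have "L = index_lattice i j t x"
  proof (rule Set.set_eqI)
    fix p :: "int \<times> int"
    show "p \<in> L \<longleftrightarrow> p \<in> index_lattice i j t x"
    proof
      assume p: "p \<in> L"
      then have "int i dvd fst p" "int j dvd snd p" using i j by blast+
      then obtain a b where "p = (a * int i, b * int j)"
        by (metis dvd_def mult.commute prod.collapse)
      with p mem show "p \<in> index_lattice i j t x" by (auto intro: index_latticeI)
    next
      assume "p \<in> index_lattice i j t x"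
      then show "p \<in> L" using mem unfolding index_lattice_def by auto
    qed
  qed
  with adm that show thesis by blast
qed

end

section \<open>Index lattices and the uniqueness of their parameters\<close>

lemma mem_index_lattice_iff:
  assumes "i > 0" "j > 0"
  shows "(u, v) \<in> index_lattice i j t x \<longleftrightarrow>
    (\<exists>a b. u = a * int i \<and> v = b * int j \<and> [b = a * int x] (mod int t))"
  unfolding index_lattice_def by auto

lemma mult_mem_index_lattice_iff:
  assumes "i > 0" "j > 0"
  shows "(a * int i, b * int j) \<in> index_lattice i j t x \<longleftrightarrow> [b = a * int x] (mod int t)"
  using assms unfolding index_lattice_def by auto

lemma subgroup_index_lattice: "subgroup (index_lattice i j t x) int_plane"
proof (rule group.subgroupI[OF group_int_plane])
  show "index_lattice i j t x \<subseteq> carrier int_plane" by auto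
  have "(0 * int i, 0 * int j) \<in> index_lattice i j t x"
    by (rule index_latticeI) simp
  then show "index_lattice i j t x \<noteq> {}" by auto
  fix p assume "p \<in> index_lattice i j t x"
  then obtain a b where p: "p = (a * int i, b * int j)" "[b = a * int x] (mod int t)"
    unfolding index_lattice_def by auto
  have "(- a * int i, - b * int j) \<in> index_lattice i j t x"
    using p(2) by (intro index_latticeI) (simp add: cong_minus_minus_iff)
  then show "inv\<^bsub>int_plane\<^esub> p \<in> index_lattice i j t x" by (simp add: p)
  fix q assume "q \<in> index_lattice i j t x"
  then obtain c d where q: "q = (c * int i, d * int j)" "[d = c * int x] (mod int t)"
    unfolding index_lattice_def by auto
  have "((a + c) * int i, (b + d) * int j) \<in> index_lattice i j t x"
    using cong_add[OF p(2) q(2)] by (intro index_latticeI) (simp add: distrib_right)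
  then show "p \<otimes>\<^bsub>int_plane\<^esub> q \<in> index_lattice i j t x" by (simp add: p q distrib_right)
qed

text \<open>Take \<open>a = m div i\<close>, \<open>b = 0\<close> and \<open>a = 0\<close>,
  \<open>b = n div j\<close>; the congruences hold because \<open>t\<close> divides both quotients.
  These two pairs will generate the kernel of the exponent map.\<close>

lemma periods_mem_index_lattice:
  assumes "admissible m n i j t x"
  shows "(int m, 0) \<in> index_lattice i j t x" "(0, int n) \<in> index_lattice i j t x"
proof -
  have m: "int m = int (m div i) * int i" and n: "int n = int (n div j) * int j"
    and t: "int t dvd int (m div i)" "int t dvd int (n div j)"
    and pos: "i > 0" "j > 0"
    using assms unfolding admissible_def by (simp_all flip: of_nat_mult)
  have "[0 = int (m div i) * int x] (mod int t)" "[int (n div j) = 0 * int x] (mod int t)"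
    using t by (simp_all add: cong_iff_dvd_diff)
  then show "(int m, 0) \<in> index_lattice i j t x" "(0, int n) \<in> index_lattice i j t x"
    using mult_mem_index_lattice_iff[OF pos, of "int (m div i)" 0]
      mult_mem_index_lattice_iff[OF pos, of 0 "int (n div j)"] m n by auto
qed

text \<open>The first lattice attains \<open>i\<close> as a first coordinate (\<open>a = 1\<close>,
  \<open>b = x\<close>) and \<open>j\<close> as a second one (\<open>b = 1\<close>, with
  \<open>a\<close> inverse to \<open>x\<close> modulo \<open>t\<close>), while all coordinates in
  the second lattice are multiples of \<open>i'\<close> and \<open>j'\<close>. Exchanging the
  lattices gives equality.\<close>

lemma index_lattice_dvd:
  assumes adm: "admissible m n i j t x" and adm': "admissible m n i' j' t' x'"
    and eq: "index_lattice i j t x = index_lattice i' j' t' x'"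
  shows "i' dvd i" "j' dvd j"
proof -
  have pos: "i > 0" "j > 0" "i' > 0" "j' > 0"
    using adm adm' by (auto simp: admissible_def)
  have "(1 * int i, int x * int j) \<in> index_lattice i' j' t' x'"
    using mult_mem_index_lattice_iff[OF pos(1,2), of 1 "int x" t x] eq by simp
  then show "i' dvd i"
    unfolding mem_index_lattice_iff[OF pos(3,4)] by (metis dvd_triv_right int_dvd_int_iff mult_1)
  have "coprime (int x) (int t)" using adm by (simp add: admissible_def coprime_iff_gcd_eq_1)
  then obtain y where "[int x * y = 1] (mod int t)" using cong_solve_coprime_int by blast
  then have "(y * int i, 1 * int j) \<in> index_lattice i' j' t' x'"
    using mult_mem_index_lattice_iff[OF pos(1,2), of y 1 t x] eq
    by (simp add: cong_sym_eq mult.commute)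
  then show "j' dvd j"
    unfolding mem_index_lattice_iff[OF pos(3,4)] by (metis dvd_triv_right int_dvd_int_iff mult_1)
qed

lemma index_lattice_inj:
  assumes adm: "admissible m n i j t x" and adm': "admissible m n i' j' t' x'"
    and eq: "index_lattice i j t x = index_lattice i' j' t' x'"
  shows "(i, j, t, x) = (i', j', t', x')"
proof -
  have ij: "i' = i" "j' = j"
    using index_lattice_dvd[OF adm adm' eq] index_lattice_dvd[OF adm' adm eq[symmetric]]
    by (auto intro: dvd_antisym)
  have pos: "i > 0" "j > 0" using adm by (auto simp: admissible_def)
  have cong: "[b = a * int x] (mod int t) \<longleftrightarrow> [b = a * int x'] (mod int t')" for a b
    using eq mult_mem_index_lattice_iff[OF pos] ij by blast
  \<comment> \<open>The pairs with \<open>a = 0\<close> determine \<open>t\<close>; those with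
    \<open>a = 1\<close> then determine \<open>x\<close> modulo \<open>t\<close>.\<close>
  have "int t dvd b \<longleftrightarrow> int t' dvd b" for b
    using cong[of b 0] by (simp add: cong_0_iff)
  then have t: "t' = t" by (meson dvd_antisym dvd_refl int_dvd_int_iff)
  have "[int x = int x'] (mod int t)" using cong[of "int x" 1] t by simp
  then have "int t dvd int x - int x'" by (simp add: cong_iff_dvd_diff)
  \<comment> \<open>Both numbers lie between 1 and \<open>t\<close>, so congruence modulo
    \<open>t\<close> forces equality.\<close>
  moreover have "\<bar>int x - int x'\<bar> < int t" using adm adm' t by (auto simp: admissible_def)
  ultimately have "x' = x" using dvd_imp_le_int[of "int x - int x'" "int t"] by auto
  with ij t show ?thesis by simp
qed

section \<open>Transfer to the product of the cyclic groups\<close>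

definition exponent_map :: "('a, 'b) ring_scheme \<Rightarrow> 'a \<Rightarrow> 'a \<Rightarrow> int \<times> int \<Rightarrow> 'a \<times> 'a"
  where "exponent_map K \<alpha> \<beta> = (\<lambda>(u, v). (\<alpha> [^]\<^bsub>mult_of K\<^esub> u, \<beta> [^]\<^bsub>mult_of K\<^esub> v))"

lemma H_set_eq_image: "H_set K \<alpha> \<beta> i j t x = exponent_map K \<alpha> \<beta> ` index_lattice i j t x"
  unfolding H_set_def index_lattice_def exponent_map_def by fast

text \<open>HOL-Algebra has two constants \<open>mult_of\<close> with the same defining equation; here the name denotes
  the one of \<^theory>\<open>HOL-Algebra.Ring_Divisibility\<close>.\<close>

lemma (in field) group_mult_of: "group (mult_of R)"
  using field_mult_group by (simp add: Multiplicative_Group.mult_of_def mult_of_def)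

text \<open>The order divides \<open>m\<close>, and minimality of \<open>m\<close> excludes a
  smaller order. Knowing the order turns triviality of integer powers into divisibility, which
  describes the kernel of \<open>exponent_map\<close>.\<close>

lemma (in field) primitive_root_of_unity_mult_of:
  assumes "primitive_root_of_unity R m z"
  shows "z \<in> carrier (mult_of R)" "group.ord (mult_of R) z = m"
proof -
  interpret M: group "mult_of R" by (rule group_mult_of)
  have z: "z \<in> carrier R" "m > 0" "z [^] m = \<one>"
    and least: "\<And>k. 0 < k \<Longrightarrow> k < m \<Longrightarrow> z [^] k \<noteq> \<one>"
    using assms by (auto simp: primitive_root_of_unity_def)
  \<comment> \<open>A positive power of zero is zero and cannot be one.\<close>
  then have "z \<noteq> \<zero>" by (metis nat_pow_zero neq0_conv one_not_zero)
  then show zM: "z \<in> carrier (mult_of R)" using z by simp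
  have "M.ord z dvd m" using M.pow_eq_id[OF zM, of m] z by (simp add: nat_pow_mult_of)
  moreover have "z [^] M.ord z = \<one>" using M.pow_ord_eq_1[OF zM] by (simp add: nat_pow_mult_of)
  ultimately show "M.ord z = m"
    using least[of "M.ord z"] z(2) by (metis dvd_imp_le dvd_pos_nat le_neq_implies_less)
qed

context
  fixes K :: "('a, 'b) ring_scheme" and \<alpha> \<beta> :: 'a and m n :: nat
  assumes field: "field K"
    and \<alpha>: "primitive_root_of_unity K m \<alpha>" and \<beta>: "primitive_root_of_unity K n \<beta>"
begin

interpretation M: group "mult_of K"
  by (rule field.group_mult_of[OF field])

lemmas \<alpha>_mult = field.primitive_root_of_unity_mult_of[OF field \<alpha>]
lemmas \<beta>_mult = field.primitive_root_of_unity_mult_of[OF field \<beta>]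

interpretation E: group_hom int_plane "cyclic_units K \<alpha> \<times>\<times> cyclic_units K \<beta>" "exponent_map K \<alpha> \<beta>"
proof -
  have "group (cyclic_units K \<alpha> \<times>\<times> cyclic_units K \<beta>)"
    unfolding cyclic_units_def by (simp add: DirProd_group)
  moreover have "exponent_map K \<alpha> \<beta> \<in> hom int_plane (cyclic_units K \<alpha> \<times>\<times> cyclic_units K \<beta>)"
    using \<alpha>_mult(1) \<beta>_mult(1)
    by (intro homI)
      (auto simp: exponent_map_def cyclic_units_def M.carrier_subgroup_generated_by_singleton
        M.int_pow_mult simp del: carrier_mult_of mult_mult_of)
  ultimately show "group_hom int_plane (cyclic_units K \<alpha> \<times>\<times> cyclic_units K \<beta>) (exponent_map K \<alpha> \<beta>)"
    using group_int_plane by (simp add: group_hom_def group_hom_axioms_def)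
qed

lemma exponent_map_surj:
  "exponent_map K \<alpha> \<beta> ` UNIV = carrier (cyclic_units K \<alpha> \<times>\<times> cyclic_units K \<beta>)"
  using \<alpha>_mult(1) \<beta>_mult(1)
  by (simp add: exponent_map_def cyclic_units_def M.carrier_subgroup_generated_by_singleton
      image_paired_Times flip: UNIV_Times_UNIV del: carrier_mult_of)

lemma exponent_map_eq_one_iff:
  "exponent_map K \<alpha> \<beta> (u, v) = \<one>\<^bsub>cyclic_units K \<alpha> \<times>\<times> cyclic_units K \<beta>\<^esub> \<longleftrightarrow> int m dvd u \<and> int n dvd v"
  using M.int_pow_eq_id[OF \<alpha>_mult(1)] M.int_pow_eq_id[OF \<beta>_mult(1)] \<alpha>_mult(2) \<beta>_mult(2)
  by (simp add: exponent_map_def cyclic_units_def)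

text \<open>A subgroup containing the kernel of a homomorphism is recovered from its image, since
  two elements with the same image differ by an element of the kernel.\<close>

lemma vimage_exponent_map_image:
  assumes L: "subgroup L int_plane" and m: "(int m, 0) \<in> L" and n: "(0, int n) \<in> L"
  shows "exponent_map K \<alpha> \<beta> -` exponent_map K \<alpha> \<beta> ` L = L"
proof
  show "exponent_map K \<alpha> \<beta> -` exponent_map K \<alpha> \<beta> ` L \<subseteq> L"
  proof
    fix p assume "p \<in> exponent_map K \<alpha> \<beta> -` exponent_map K \<alpha> \<beta> ` L"
    then obtain q where q: "q \<in> L" "exponent_map K \<alpha> \<beta> p = exponent_map K \<alpha> \<beta> q" by auto
    obtain u v u' v' where [simp]: "p = (u, v)" "q = (u', v')" by fastforce
    have "exponent_map K \<alpha> \<beta> (p \<otimes>\<^bsub>int_plane\<^esub> inv\<^bsub>int_plane\<^esub> q)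
        = \<one>\<^bsub>cyclic_units K \<alpha> \<times>\<times> cyclic_units K \<beta>\<^esub>"
      using q(2) E.hom_mult[of p "inv\<^bsub>int_plane\<^esub> q"] E.hom_inv[of q] E.H.r_inv[of "exponent_map K \<alpha> \<beta> q"]
        E.hom_closed[of q]
      by (simp del: inv_DirProd mult_DirProd one_DirProd)
    then have "int m dvd u - u'" "int n dvd v - v'"
      using exponent_map_eq_one_iff[of "u - u'" "v - v'"] by simp_all
    then obtain k l where "u - u' = k * int m" "v - v' = l * int n"
      by (metis dvd_def mult.commute)
    \<comment> \<open>The zeros exhibit \<open>p\<close> as the sum of \<open>k\<close> times
      \<open>(m, 0)\<close>, \<open>l\<close> times \<open>(0, n)\<close> and
      \<open>q\<close>.\<close>
    then have "p = (k * int m + 0 + u', 0 + l * int n + v')" by simp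
    then show "p \<in> L"
      using lattice_add[OF L lattice_add[OF L lattice_scale[OF L m, of k] lattice_scale[OF L n, of l]]]
        q(1) by auto
  qed
qed auto

lemma subgroup_H_set: "subgroup (H_set K \<alpha> \<beta> i j t x) (cyclic_units K \<alpha> \<times>\<times> cyclic_units K \<beta>)"
  unfolding H_set_eq_image by (rule E.subgroup_img_is_subgroup[OF subgroup_index_lattice])

lemma subgroup_vimage_exponent_map:
  assumes "subgroup G (cyclic_units K \<alpha> \<times>\<times> cyclic_units K \<beta>)"
  shows "subgroup (exponent_map K \<alpha> \<beta> -` G) int_plane"
proof (rule group.subgroupI[OF group_int_plane])
  show "exponent_map K \<alpha> \<beta> -` G \<subseteq> carrier int_plane" by auto
  show "exponent_map K \<alpha> \<beta> -` G \<noteq> {}"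
    using E.hom_one subgroup.one_closed[OF assms] by (metis empty_iff vimageI)
  fix p assume p: "p \<in> exponent_map K \<alpha> \<beta> -` G"
  then show "inv\<^bsub>int_plane\<^esub> p \<in> exponent_map K \<alpha> \<beta> -` G"
    using E.hom_inv[of p] subgroup.m_inv_closed[OF assms] by (auto simp del: inv_DirProd)
  fix q assume "q \<in> exponent_map K \<alpha> \<beta> -` G"
  with p show "p \<otimes>\<^bsub>int_plane\<^esub> q \<in> exponent_map K \<alpha> \<beta> -` G"
    using E.hom_mult[of p q] subgroup.m_closed[OF assms] by (auto simp del: mult_DirProd)
qed

text \<open>The preimage of \<open>G\<close> contains the kernel, so the lattice classification
  applies to it; surjectivity of \<open>exponent_map\<close> carries the result back to
  \<open>G\<close>.\<close>

lemma subgroup_eq_H_set: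
  assumes G: "subgroup G (cyclic_units K \<alpha> \<times>\<times> cyclic_units K \<beta>)"
  obtains i j t x where "admissible m n i j t x" "G = H_set K \<alpha> \<beta> i j t x"
proof -
  let ?L = "exponent_map K \<alpha> \<beta> -` G"
  have "(int m, 0) \<in> ?L" "(0, int n) \<in> ?L"
    using exponent_map_eq_one_iff[of "int m" 0] exponent_map_eq_one_iff[of 0 "int n"]
      subgroup.one_closed[OF G] by auto
  moreover have "m > 0" "n > 0" using \<alpha> \<beta> by (auto simp: primitive_root_of_unity_def)
  ultimately obtain i j t x where adm: "admissible m n i j t x" and L: "?L = index_lattice i j t x"
    using lattice_eq_index_lattice[OF subgroup_vimage_exponent_map[OF G]] by metis
  have "G = exponent_map K \<alpha> \<beta> ` ?L"
    using exponent_map_surj subgroup.subset[OF G] by (simp add: image_vimage_eq inf.absorb1)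
  with L have "G = H_set K \<alpha> \<beta> i j t x" by (simp add: H_set_eq_image)
  with adm that show thesis by blast
qed

text \<open>Taking preimages under \<open>exponent_map\<close> recovers both index lattices, because
  each contains the kernel; this reduces uniqueness to the integer plane.\<close>

lemma H_set_inj:
  assumes adm: "admissible m n i j t x" and adm': "admissible m n i' j' t' x'"
    and eq: "H_set K \<alpha> \<beta> i j t x = H_set K \<alpha> \<beta> i' j' t' x'"
  shows "(i, j, t, x) = (i', j', t', x')"
proof (rule index_lattice_inj[OF adm adm'])
  show "index_lattice i j t x = index_lattice i' j' t' x'"
    using eq vimage_exponent_map_image[OF subgroup_index_lattice periods_mem_index_lattice[OF adm]]
      vimage_exponent_map_image[OF subgroup_index_lattice periods_mem_index_lattice[OF adm']]
    unfolding H_set_eq_image by metis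
qed

end

theorem theorem1p2:
  fixes K :: "('a, 'b) ring_scheme" and \<alpha> \<beta> :: 'a and m n :: nat
  assumes "algebraically_closed K" and "char_zero K"
    and "m > 0" and "n > 0"
    and "primitive_root_of_unity K m \<alpha>"
    and "primitive_root_of_unity K n \<beta>"
  shows "(\<forall>i j t x. admissible m n i j t x \<longrightarrow>
            subgroup (H_set K \<alpha> \<beta> i j t x) (cyclic_units K \<alpha> \<times>\<times> cyclic_units K \<beta>)) \<and>
         (\<forall>G. subgroup G (cyclic_units K \<alpha> \<times>\<times> cyclic_units K \<beta>) \<longrightarrow>
            (\<exists>!q. case q of (i, j, t, x) \<Rightarrow>
               admissible m n i j t x \<and> G = H_set K \<alpha> \<beta> i j t x))"
proof (intro conjI allI impI)
  have field: "field K" using assms(1) by (rule algebraically_closed.axioms)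
  note ctxt = field assms(5,6)
  show "subgroup (H_set K \<alpha> \<beta> i j t x) (cyclic_units K \<alpha> \<times>\<times> cyclic_units K \<beta>)" for i j t x
    by (rule subgroup_H_set[OF ctxt])
  fix G assume "subgroup G (cyclic_units K \<alpha> \<times>\<times> cyclic_units K \<beta>)"
  then obtain i j t x where "admissible m n i j t x" "G = H_set K \<alpha> \<beta> i j t x"
    using subgroup_eq_H_set[OF ctxt] by metis
  then show "\<exists>!q. case q of (i, j, t, x) \<Rightarrow> admissible m n i j t x \<and> G = H_set K \<alpha> \<beta> i j t x"
    using H_set_inj[OF ctxt] by (intro ex1I[of _ "(i, j, t, x)"]) (auto split: prod.splits)
qed

end
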